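(* Let $K$ be a field. Fix a valuation $v:K\rightarrow \Gamma\cup\{0\}$ where $\Gamma$ is a totally ordered abelian group. Let $L$ be a field extension of $K$. Then there is a totally ordered abelian group $\Gamma'\supseteq \Gamma$ (containing $\Gamma$ as an ordered subgroup) and a valuation $w:L\rightarrow \Gamma'\cup\{0\}$ such that $v=w|_K$.
   Context: Totally ordered abelian groups are written multiplicatively. For such a group $\Gamma$, $\Gamma\cup\{0\}$ is ordered with $0$ as least element, with $0\cdot x=0$, and with addition $x+y=\max(x,y)$. A valuation on a commutative ring $R$ is a map $v:R\to\Gamma\cup\{0\}$ such that: $v(0)=0$ and $v(1)=1$; $v(xy)=v(x)v(y)$; $v(x+y)\leq \max(v(x),v(y))$; and $v(x)\leq \max(v(x+y),v(y))$, for all $x,y\in R$. *)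

theory Defs
  imports "HOL-Algebra.Ring"
begin

record 'a ordered_monoid = "'a monoid" +
  ord_le :: "'a \<Rightarrow> 'a \<Rightarrow> bool" (infixl "\<preceq>\<index>" 50)

locale totally_ordered_comm_group = comm_group G
  for G :: "('a, 'm) ordered_monoid_scheme" (structure) +
  assumes le_refl: "reflp_on (carrier G) (ord_le G)"
    and le_antisym: "antisymp_on (carrier G) (ord_le G)"
    and le_trans: "transp_on (carrier G) (ord_le G)"
    and le_total: "totalp_on (carrier G) (ord_le G)"
    and le_mult_right:
      "\<lbrakk>x \<in> carrier G; y \<in> carrier G; z \<in> carrier G; x \<preceq> y\<rbrakk> \<Longrightarrow> x \<otimes> z \<preceq> y \<otimes> z"

text \<open>
  \<open>G\<close> sits in \<open>H\<close> as an ordered subgroup via \<open>\<iota>\<close>: the order of \<open>G\<close> is the one induced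
  from \<open>H\<close>.
\<close>

definition ordered_group_embedding ::
  "('a \<Rightarrow> 'b) \<Rightarrow> ('a, 'm) ordered_monoid_scheme \<Rightarrow> ('b, 'n) ordered_monoid_scheme \<Rightarrow> bool"
  where "ordered_group_embedding \<iota> G H \<longleftrightarrow>
    \<iota> \<in> hom G H \<and> inj_on \<iota> (carrier G) \<and>
    (\<forall>x\<in>carrier G. \<forall>y\<in>carrier G. \<iota> x \<preceq>\<^bsub>H\<^esub> \<iota> y \<longleftrightarrow> x \<preceq>\<^bsub>G\<^esub> y)"

text \<open>
  The ordered semiring \<open>G \<union> {0}\<close>. The value \<open>None\<close> plays the role of \<open>0\<close>, and \<open>Some g\<close> that
  of \<open>g\<close>. Semiring addition is the maximum.
\<close>

fun with_zero_le ::
  "('a, 'm) ordered_monoid_scheme \<Rightarrow> 'a option \<Rightarrow> 'a option \<Rightarrow> bool"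
  where
    "with_zero_le G None b \<longleftrightarrow> True"
  | "with_zero_le G (Some x) None \<longleftrightarrow> False"
  | "with_zero_le G (Some x) (Some y) \<longleftrightarrow> x \<preceq>\<^bsub>G\<^esub> y"

fun with_zero_mult ::
  "('a, 'm) ordered_monoid_scheme \<Rightarrow> 'a option \<Rightarrow> 'a option \<Rightarrow> 'a option"
  where
    "with_zero_mult G (Some x) (Some y) = Some (x \<otimes>\<^bsub>G\<^esub> y)"
  | "with_zero_mult G _ _ = None"

definition with_zero_max ::
  "('a, 'm) ordered_monoid_scheme \<Rightarrow> 'a option \<Rightarrow> 'a option \<Rightarrow> 'a option"
  where "with_zero_max G a b = (if with_zero_le G a b then b else a)"

definition with_zero :: "('a, 'm) ordered_monoid_scheme \<Rightarrow> 'a option ring"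
  where "with_zero G =
    \<lparr>carrier = insert None (Some ` carrier G),
     monoid.mult = with_zero_mult G, one = Some \<one>\<^bsub>G\<^esub>,
     ring.zero = None, add = with_zero_max G\<rparr>"

locale valuation = cring R + val_group: totally_ordered_comm_group G
  for R :: "('r, 'n) ring_scheme" (structure)
    and G :: "('a, 'm) ordered_monoid_scheme" +
  fixes v :: "'r \<Rightarrow> 'a option"
  assumes val_closed: "v \<in> carrier R \<rightarrow> carrier (with_zero G)"
    and val_zero: "v \<zero> = \<zero>\<^bsub>with_zero G\<^esub>"
    and val_one: "v \<one> = \<one>\<^bsub>with_zero G\<^esub>"
    and val_mult: "\<lbrakk>x \<in> carrier R; y \<in> carrier R\<rbrakk> \<Longrightarrow>
      v (x \<otimes> y) = v x \<otimes>\<^bsub>with_zero G\<^esub> v y"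
    and val_add: "\<lbrakk>x \<in> carrier R; y \<in> carrier R\<rbrakk> \<Longrightarrow>
      with_zero_le G (v (x \<oplus> y)) (v x \<oplus>\<^bsub>with_zero G\<^esub> v y)"
    and val_add': "\<lbrakk>x \<in> carrier R; y \<in> carrier R\<rbrakk> \<Longrightarrow>
      with_zero_le G (v x) (v (x \<oplus> y) \<oplus>\<^bsub>with_zero G\<^esub> v y)"

end

theory Submission
  imports Defs "HOL-Algebra.QuotRing"
begin

text \<open>
  A valuation \<open>w\<close> of \<open>L\<close> is encoded by the set \<open>P\<close> of all pairs \<open>(c, a)\<close> with \<open>w a \<le> c\<close>, where \<open>c\<close>
  ranges over \<open>\<Gamma>\<close>; equivalently, by a graded subring of the group algebra \<open>L[\<Gamma>]\<close> that is increasing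
  in the degree. The valuation \<open>v\<close> gives such a set, which is proper: it contains \<open>(c, 1)\<close> only for
  \<open>c \<ge> 1\<close>. By Zorn's lemma it lies in a maximal proper one. Chevalley's argument on the
  relations of least degree shows that a maximal proper \<open>P\<close> contains \<open>(c, x)\<close> or its inverse
  for all \<open>c\<close> and all \<open>x \<noteq> 0\<close>. Hence \<open>P\<close> defines a total preorder on the group \<open>\<Gamma> \<times> L\<^sup>*\<close>,
  and \<open>\<Gamma>'\<close> is the quotient of this group by the pairs equivalent to \<open>1\<close>. Working with pairs
  from the start avoids extending the order to the pushout of \<open>\<Gamma>\<close> and a value group of \<open>L\<close>, which may
  have torsion.
\<close>

section \<open>Totally ordered abelian groups\<close>

context totally_ordered_comm_group
begin

lemma ord_refl [simp]: "x \<in> carrier G \<Longrightarrow> x \<preceq> x"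
  using le_refl by (auto simp: reflp_on_def)

lemma ord_antisym:
  "\<lbrakk>x \<preceq> y; y \<preceq> x; x \<in> carrier G; y \<in> carrier G\<rbrakk> \<Longrightarrow> x = y"
  using le_antisym by (auto simp: antisymp_on_def)

lemma ord_trans:
  "\<lbrakk>x \<preceq> y; y \<preceq> z; x \<in> carrier G; y \<in> carrier G; z \<in> carrier G\<rbrakk> \<Longrightarrow> x \<preceq> z"
  using le_trans unfolding transp_on_def by blast

lemma ord_linear: "\<lbrakk>x \<in> carrier G; y \<in> carrier G\<rbrakk> \<Longrightarrow> x \<preceq> y \<or> y \<preceq> x"
  using le_total ord_refl unfolding totalp_on_def by metis

lemma inv_cancel:
  assumes "x \<in> carrier G" "y \<in> carrier G"
  shows "inv x \<otimes> (x \<otimes> y) = y" "x \<otimes> (inv x \<otimes> y) = y"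
  using assms by (simp_all flip: m_assoc)

lemma ord_mult_mono:
  assumes "x \<preceq> x'" "y \<preceq> y'"
    and "x \<in> carrier G" "x' \<in> carrier G" "y \<in> carrier G" "y' \<in> carrier G"
  shows "x \<otimes> y \<preceq> x' \<otimes> y'"
proof -
  have "x \<otimes> y \<preceq> x' \<otimes> y" by (simp add: assms le_mult_right)
  moreover have "x' \<otimes> y \<preceq> x' \<otimes> y'"
    using le_mult_right[of y y' x'] assms by (simp add: m_comm)
  ultimately show ?thesis using ord_trans assms by (meson m_closed)
qed

lemma ord_iff_one_ord_div:
  assumes "x \<in> carrier G" "y \<in> carrier G"
  shows "x \<preceq> y \<longleftrightarrow> \<one> \<preceq> y \<otimes> inv x"
  using le_mult_right[of x y "inv x"] le_mult_right[of \<one> "y \<otimes> inv x" x] assms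
  by (auto simp: m_assoc)

end

section \<open>Ordered quotient of an abelian group by a total cone\<close>

locale total_cone = comm_group +
  fixes C
  assumes cone_subset: "C \<subseteq> carrier G"
    and cone_one: "\<one> \<in> C"
    and cone_mult: "\<lbrakk>x \<in> C; y \<in> C\<rbrakk> \<Longrightarrow> x \<otimes> y \<in> C"
    and cone_total: "x \<in> carrier G \<Longrightarrow> x \<in> C \<or> inv x \<in> C"
begin

text \<open>The cone collects the elements that are at least \<open>\<one>\<close> in a total
  preorder compatible with multiplication. The kernel is the equivalence class of
  \<open>\<one>\<close>, and dividing by it makes the preorder antisymmetric.\<close>

definition cone_kernel where "cone_kernel = {x \<in> C. inv x \<in> C}"

text \<open>The group structure is that of \<open>G Mod cone_kernel\<close>, in a record with room
  for an order. The order asks for a single comparable pair of representatives;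
  \<open>coset_le_iff\<close> shows that their choice is immaterial.\<close>

definition cone_quotient :: "'a set ordered_monoid" where
  "cone_quotient =
    \<lparr>carrier = rcosets cone_kernel, monoid.mult = set_mult G, one = cone_kernel,
     ord_le = \<lambda>X Y. \<exists>x\<in>X. \<exists>y\<in>Y. y \<otimes> inv x \<in> C\<rparr>"

lemma cone_closed [simp]: "x \<in> C \<Longrightarrow> x \<in> carrier G"
  using cone_subset by blast

lemma subgroup_cone_kernel: "subgroup cone_kernel G"
proof (rule subgroupI)
  show "cone_kernel \<noteq> {}" using cone_one by (auto simp: cone_kernel_def intro!: exI[of _ \<one>])
qed (auto simp: cone_kernel_def cone_mult inv_mult)

sublocale kernel: normal cone_kernel G
  by (rule subgroup_imp_normal[OF subgroup_cone_kernel])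

lemma cone_quotient_simps [simp]:
  "carrier cone_quotient = rcosets cone_kernel"
  "monoid.mult cone_quotient = set_mult G"
  "one cone_quotient = cone_kernel"
  by (simp_all add: cone_quotient_def)

lemma coset_eq_iff:
  assumes "x \<in> carrier G" "y \<in> carrier G"
  shows "cone_kernel #> x = cone_kernel #> y \<longleftrightarrow> y \<otimes> inv x \<in> cone_kernel"
  using assms kernel.rcos_module[OF is_group, of x y] rcos_self[OF assms(2) subgroup_cone_kernel]
    repr_independence[OF _ assms(1) subgroup_cone_kernel] by metis

text \<open>Changing representatives to \<open>k \<otimes> x\<close> and
  \<open>l \<otimes> y\<close> with \<open>k\<close>, \<open>l\<close> in the kernel multiplies the
  quotient of \<open>y\<close> by \<open>x\<close> by \<open>l \<otimes> inv k\<close>. The inverse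
  of this factor also lies in the cone, so the change can be undone there.\<close>

lemma coset_le_iff:
  assumes "x \<in> carrier G" "y \<in> carrier G"
  shows "ord_le cone_quotient (cone_kernel #> x) (cone_kernel #> y) \<longleftrightarrow> y \<otimes> inv x \<in> C"
proof
  assume "y \<otimes> inv x \<in> C"
  then show "ord_le cone_quotient (cone_kernel #> x) (cone_kernel #> y)"
    using rcos_self[OF _ subgroup_cone_kernel] assms by (auto simp: cone_quotient_def)
next
  assume "ord_le cone_quotient (cone_kernel #> x) (cone_kernel #> y)"
  then obtain k l where k: "k \<in> C" "inv k \<in> C" and l: "l \<in> C" "inv l \<in> C"
    and "(l \<otimes> y) \<otimes> inv (k \<otimes> x) \<in> C"
    unfolding cone_quotient_def r_coset_def cone_kernel_def by auto
  then have "k \<otimes> inv l \<otimes> ((l \<otimes> y) \<otimes> inv (k \<otimes> x)) \<in> C"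
    by (metis cone_mult)
  also have "k \<otimes> inv l \<otimes> ((l \<otimes> y) \<otimes> inv (k \<otimes> x)) = (k \<otimes> inv k) \<otimes> (inv l \<otimes> l) \<otimes> (y \<otimes> inv x)"
    using assms k l by (simp add: inv_mult m_ac del: r_inv l_inv Units_r_inv Units_l_inv)
  also have "\<dots> = y \<otimes> inv x" using assms k l by simp
  finally show "y \<otimes> inv x \<in> C" .
qed

lemma comm_group_cone_quotient: "comm_group cone_quotient"
proof -
  interpret Q: comm_group "G Mod cone_kernel"
    by (rule abelian_FactGroup[OF subgroup_cone_kernel])
  show ?thesis
    by (rule comm_groupI)
      (use Q.m_closed Q.m_assoc Q.m_comm Q.one_closed Q.l_one Q.l_inv_ex
        in \<open>simp_all add: FactGroup_def\<close>)
qed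

lemma totally_ordered_cone_quotient: "totally_ordered_comm_group cone_quotient"
proof -
  interpret Q: comm_group cone_quotient by (rule comm_group_cone_quotient)
  have coset: "\<exists>x\<in>carrier G. X = cone_kernel #> x" if "X \<in> carrier cone_quotient" for X
    using that by (auto simp: RCOSETS_def)
  show ?thesis
  proof unfold_locales
    show "reflp_on (carrier cone_quotient) (ord_le cone_quotient)"
    proof (rule reflp_onI)
      fix X assume "X \<in> carrier cone_quotient"
      then obtain x where "x \<in> carrier G" "X = cone_kernel #> x" using coset by blast
      then show "ord_le cone_quotient X X" by (simp add: coset_le_iff cone_one)
    qed
    show "antisymp_on (carrier cone_quotient) (ord_le cone_quotient)"
    proof (rule antisymp_onI)
      fix X Y assume "X \<in> carrier cone_quotient" "Y \<in> carrier cone_quotient"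
        and le: "ord_le cone_quotient X Y" "ord_le cone_quotient Y X"
      then obtain x y where xy: "x \<in> carrier G" "X = cone_kernel #> x"
        "y \<in> carrier G" "Y = cone_kernel #> y" using coset by meson
      with le have "y \<otimes> inv x \<in> cone_kernel"
        by (simp add: coset_le_iff inv_mult m_comm cone_kernel_def[THEN eqset_imp_iff])
      with xy show "X = Y" by (simp add: coset_eq_iff)
    qed
    show "transp_on (carrier cone_quotient) (ord_le cone_quotient)"
    proof (rule transp_onI)
      fix X Y Z
      assume "X \<in> carrier cone_quotient" "Y \<in> carrier cone_quotient" "Z \<in> carrier cone_quotient"
        and le: "ord_le cone_quotient X Y" "ord_le cone_quotient Y Z"
      then obtain x y z where xyz: "x \<in> carrier G" "X = cone_kernel #> x"
        "y \<in> carrier G" "Y = cone_kernel #> y" "z \<in> carrier G" "Z = cone_kernel #> z"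
        using coset by meson
      have "z \<otimes> inv y \<otimes> (y \<otimes> inv x) = z \<otimes> (inv y \<otimes> y) \<otimes> inv x"
        using xyz by (simp only: m_assoc m_closed inv_closed)
      also have "\<dots> = z \<otimes> inv x" using xyz by simp
      finally have "z \<otimes> inv y \<otimes> (y \<otimes> inv x) = z \<otimes> inv x" .
      moreover from xyz le have "(z \<otimes> inv y) \<otimes> (y \<otimes> inv x) \<in> C"
        by (auto simp: coset_le_iff intro: cone_mult[of "z \<otimes> inv y"])
      ultimately show "ord_le cone_quotient X Z"
        using xyz by (simp add: coset_le_iff)
    qed
    show "totalp_on (carrier cone_quotient) (ord_le cone_quotient)"
    proof (rule totalp_onI)
      fix X Y assume "X \<in> carrier cone_quotient" "Y \<in> carrier cone_quotient"
      then obtain x y where xy: "x \<in> carrier G" "X = cone_kernel #> x"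
        "y \<in> carrier G" "Y = cone_kernel #> y" using coset by meson
      then show "ord_le cone_quotient X Y \<or> ord_le cone_quotient Y X"
        using cone_total[of "y \<otimes> inv x"] by (simp add: coset_le_iff inv_mult m_comm)
    qed
    fix X Y Z
    assume "X \<in> carrier cone_quotient" "Y \<in> carrier cone_quotient" "Z \<in> carrier cone_quotient"
      and le: "ord_le cone_quotient X Y"
    then obtain x y z where xyz: "x \<in> carrier G" "X = cone_kernel #> x"
      "y \<in> carrier G" "Y = cone_kernel #> y" "z \<in> carrier G" "Z = cone_kernel #> z"
      using coset by meson
    have "y \<otimes> z \<otimes> inv (x \<otimes> z) = y \<otimes> inv x \<otimes> (z \<otimes> inv z)"
      using xyz by (simp add: inv_mult m_ac del: r_inv l_inv Units_r_inv Units_l_inv)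
    with xyz le show "ord_le cone_quotient (X \<otimes>\<^bsub>cone_quotient\<^esub> Z) (Y \<otimes>\<^bsub>cone_quotient\<^esub> Z)"
      by (simp add: kernel.rcos_sum coset_le_iff)
  qed
qed

end

section \<open>Filtrations of a field, and adjoining a homogeneous element\<close>

locale field_with_ordered_group = field L + val_group: totally_ordered_comm_group G
  for L :: "('l, 'n) ring_scheme" (structure)
    and G :: "('g, 'p) ordered_monoid_scheme"

text \<open>Read \<open>(c, a) \<in> P\<close> as the bound \<open>w a \<le> c\<close>. The axioms
  also admit the set of all pairs; properness is kept as a separate condition so that it can fail
  for the filtrations produced by \<open>adjoin\<close>.\<close>

locale filtration = field_with_ordered_group +
  fixes P
  assumes subset: "P \<subseteq> carrier G \<times> carrier L"
    and has_zero: "c \<in> carrier G \<Longrightarrow> (c, \<zero>) \<in> P"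
    and has_one: "(\<one>\<^bsub>G\<^esub>, \<one>) \<in> P"
    and add: "\<lbrakk>(c, a) \<in> P; (c, b) \<in> P\<rbrakk> \<Longrightarrow> (c, a \<oplus> b) \<in> P"
    and minus: "(c, a) \<in> P \<Longrightarrow> (c, \<ominus> a) \<in> P"
    and mult: "\<lbrakk>(c, a) \<in> P; (d, b) \<in> P\<rbrakk> \<Longrightarrow> (c \<otimes>\<^bsub>G\<^esub> d, a \<otimes> b) \<in> P"
    and mono: "\<lbrakk>(c, a) \<in> P; d \<in> carrier G; c \<preceq>\<^bsub>G\<^esub> d\<rbrakk> \<Longrightarrow> (d, a) \<in> P"
begin

lemma closed: "(c, a) \<in> P \<Longrightarrow> c \<in> carrier G" "(c, a) \<in> P \<Longrightarrow> a \<in> carrier L"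
  using subset by auto

text \<open>
  The elements \<open>(d, \<Sum>i\<le>n. a\<^sub>i x\<^sup>i)\<close> with \<open>(c\<^bsup>-i\<^esup> d, a\<^sub>i) \<in> P\<close>: polynomials over \<open>P\<close> in the homogeneous
  element \<open>x\<close> of degree \<open>c\<close>.
\<close>

primrec adjoin :: "'c \<Rightarrow> 'a \<Rightarrow> nat \<Rightarrow> ('c \<times> 'a) set" where
  "adjoin c x 0 = P"
| "adjoin c x (Suc n) =
    {(d, a \<oplus> x \<otimes> b) |d a b. (d, a) \<in> P \<and> (inv\<^bsub>G\<^esub> c \<otimes>\<^bsub>G\<^esub> d, b) \<in> adjoin c x n}"

context
  fixes c x
  assumes c: "c \<in> carrier G" and x: "x \<in> carrier L"
begin

lemma adjoin_closed: "(d, q) \<in> adjoin c x n \<Longrightarrow> d \<in> carrier G \<and> q \<in> carrier L"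
proof (induction n arbitrary: d q)
  case 0
  then show ?case using closed by auto
next
  case (Suc n)
  then obtain a b where "q = a \<oplus> x \<otimes> b" "(d, a) \<in> P" "(inv\<^bsub>G\<^esub> c \<otimes>\<^bsub>G\<^esub> d, b) \<in> adjoin c x n" by auto
  with Suc.IH closed x show ?case by blast
qed

lemma adjoin_zero: "d \<in> carrier G \<Longrightarrow> (d, \<zero>) \<in> adjoin c x n"
proof (induction n arbitrary: d)
  case (Suc n)
  then have "(inv\<^bsub>G\<^esub> c \<otimes>\<^bsub>G\<^esub> d, \<zero>) \<in> adjoin c x n" using c by simp
  with Suc.prems x has_zero[of d] show ?case by force
qed (simp add: has_zero)

lemma adjoin_Suc_iff:
  "(d, q) \<in> adjoin c x (Suc n) \<longleftrightarrow>
    (\<exists>a b. q = a \<oplus> x \<otimes> b \<and> (d, a) \<in> P \<and> (inv\<^bsub>G\<^esub> c \<otimes>\<^bsub>G\<^esub> d, b) \<in> adjoin c x n)"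
  by auto

lemma adjoin_times:
  assumes "(d, q) \<in> adjoin c x n"
  shows "(c \<otimes>\<^bsub>G\<^esub> d, x \<otimes> q) \<in> adjoin c x (Suc n)"
proof -
  have [simp]: "d \<in> carrier G" "q \<in> carrier L" using adjoin_closed[OF assms] by auto
  have "x \<otimes> q = \<zero> \<oplus> x \<otimes> q" using x by simp
  moreover have "(c \<otimes>\<^bsub>G\<^esub> d, \<zero>) \<in> P" using c by (simp add: has_zero)
  moreover have "inv\<^bsub>G\<^esub> c \<otimes>\<^bsub>G\<^esub> (c \<otimes>\<^bsub>G\<^esub> d) = d" using c by (simp add: val_group.inv_cancel)
  ultimately show ?thesis unfolding adjoin_Suc_iff using assms by auto
qed

lemma subset_adjoin: "P \<subseteq> adjoin c x n"
proof (cases n)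
  case (Suc k)
  have "(d, a) \<in> adjoin c x (Suc k)" if "(d, a) \<in> P" for d a
  proof -
    have "a = a \<oplus> x \<otimes> \<zero>" using closed[OF that] x by simp
    moreover have "(inv\<^bsub>G\<^esub> c \<otimes>\<^bsub>G\<^esub> d, \<zero>) \<in> adjoin c x k"
      using closed[OF that] c by (simp add: adjoin_zero)
    ultimately show ?thesis unfolding adjoin_Suc_iff using that by blast
  qed
  then show ?thesis using Suc by auto
qed simp

lemma adjoin_Suc_subset: "adjoin c x n \<subseteq> adjoin c x (Suc n)"
proof (induction n)
  case 0
  show ?case using subset_adjoin[of "Suc 0"] by simp
next
  case (Suc n)
  show ?case
  proof (rule subrelI)
    fix d q assume "(d, q) \<in> adjoin c x (Suc n)"
    then obtain a b where q: "q = a \<oplus> x \<otimes> b" "(d, a) \<in> P"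
      and "(inv\<^bsub>G\<^esub> c \<otimes>\<^bsub>G\<^esub> d, b) \<in> adjoin c x n"
      by auto
    then have "(inv\<^bsub>G\<^esub> c \<otimes>\<^bsub>G\<^esub> d, b) \<in> adjoin c x (Suc n)" using Suc.IH by blast
    then show "(d, q) \<in> adjoin c x (Suc (Suc n))"
      unfolding adjoin_Suc_iff[of d q "Suc n"] using q by blast
  qed
qed

lemma adjoin_subset: "n \<le> m \<Longrightarrow> adjoin c x n \<subseteq> adjoin c x m"
  by (rule lift_Suc_mono_le[of "adjoin c x"]) (rule adjoin_Suc_subset)

lemma adjoin_add:
  "\<lbrakk>(d, p) \<in> adjoin c x n; (d, q) \<in> adjoin c x n\<rbrakk> \<Longrightarrow> (d, p \<oplus> q) \<in> adjoin c x n"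
proof (induction n arbitrary: d p q)
  case (Suc n)
  obtain a b where p: "p = a \<oplus> x \<otimes> b" "(d, a) \<in> P" "(inv\<^bsub>G\<^esub> c \<otimes>\<^bsub>G\<^esub> d, b) \<in> adjoin c x n"
    using Suc.prems(1) by auto
  obtain a' b' where q: "q = a' \<oplus> x \<otimes> b'" "(d, a') \<in> P" "(inv\<^bsub>G\<^esub> c \<otimes>\<^bsub>G\<^esub> d, b') \<in> adjoin c x n"
    using Suc.prems(2) by auto
  have "p \<oplus> q = (a \<oplus> a') \<oplus> x \<otimes> (b \<oplus> b')"
    using p q x closed adjoin_closed[OF p(3)] adjoin_closed[OF q(3)]
    by (simp add: r_distr a_ac)
  then show ?case unfolding adjoin_Suc_iff using p q Suc.IH add by blast
qed (simp add: add)

lemma adjoin_mono: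
  "\<lbrakk>(d, q) \<in> adjoin c x n; e \<in> carrier G; d \<preceq>\<^bsub>G\<^esub> e\<rbrakk> \<Longrightarrow> (e, q) \<in> adjoin c x n"
proof (induction n arbitrary: d e q)
  case 0
  then show ?case using mono by auto
next
  case (Suc n)
  obtain a b where q: "q = a \<oplus> x \<otimes> b" "(d, a) \<in> P" "(inv\<^bsub>G\<^esub> c \<otimes>\<^bsub>G\<^esub> d, b) \<in> adjoin c x n"
    using Suc.prems(1) by auto
  have "inv\<^bsub>G\<^esub> c \<otimes>\<^bsub>G\<^esub> d \<preceq>\<^bsub>G\<^esub> inv\<^bsub>G\<^esub> c \<otimes>\<^bsub>G\<^esub> e"
    using c Suc.prems closed[OF q(2)] by (intro val_group.ord_mult_mono) auto
  with q Suc c have "(inv\<^bsub>G\<^esub> c \<otimes>\<^bsub>G\<^esub> e, b) \<in> adjoin c x n" by blast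
  then show ?case using q mono Suc.prems unfolding adjoin_Suc_iff by blast
qed

lemma adjoin_scale:
  "\<lbrakk>(d, a) \<in> P; (e, q) \<in> adjoin c x n\<rbrakk> \<Longrightarrow> (d \<otimes>\<^bsub>G\<^esub> e, a \<otimes> q) \<in> adjoin c x n"
proof (induction n arbitrary: e q)
  case (Suc n)
  obtain a' b where q: "q = a' \<oplus> x \<otimes> b" "(e, a') \<in> P" "(inv\<^bsub>G\<^esub> c \<otimes>\<^bsub>G\<^esub> e, b) \<in> adjoin c x n"
    using Suc.prems(2) by auto
  have "a \<otimes> q = (a \<otimes> a') \<oplus> x \<otimes> (a \<otimes> b)"
    using q x closed Suc.prems adjoin_closed[OF q(3)] by (simp add: r_distr m_ac)
  moreover have "(inv\<^bsub>G\<^esub> c \<otimes>\<^bsub>G\<^esub> (d \<otimes>\<^bsub>G\<^esub> e), a \<otimes> b) \<in> adjoin c x n"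
    using Suc.IH[OF Suc.prems(1) q(3)] closed(1)[OF Suc.prems(1)] closed(1)[OF q(2)] c
    by (simp add: val_group.m_lcomm)
  ultimately show ?case
    unfolding adjoin_Suc_iff using q Suc.prems mult by blast
qed (simp add: mult)

text \<open>Negation is scaling by \<open>\<ominus> \<one>\<close>, a coefficient of degree
  \<open>\<one>\<close>.\<close>

lemma adjoin_minus: "(d, q) \<in> adjoin c x n \<Longrightarrow> (d, \<ominus> q) \<in> adjoin c x n"
  using adjoin_scale[OF minus[OF has_one]] adjoin_closed[of d q n] by (force simp: l_minus)

text \<open>Horner induction on the first factor alone: its constant term scales \<open>q\<close>,
  and the remaining product is shifted by one power of \<open>x\<close>.\<close>

lemma adjoin_mult:
  "\<lbrakk>(d, p) \<in> adjoin c x n; (e, q) \<in> adjoin c x m\<rbrakk> \<Longrightarrow> (d \<otimes>\<^bsub>G\<^esub> e, p \<otimes> q) \<in> adjoin c x (n + m)"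
proof (induction n arbitrary: d p)
  case 0
  then show ?case by (simp add: adjoin_scale)
next
  case (Suc n)
  obtain a b where p: "p = a \<oplus> x \<otimes> b" "(d, a) \<in> P" "(inv\<^bsub>G\<^esub> c \<otimes>\<^bsub>G\<^esub> d, b) \<in> adjoin c x n"
    using Suc.prems(1) by auto
  note [simp] = closed[OF p(2)] conjunct2[OF adjoin_closed[OF p(3)]]
    adjoin_closed[OF Suc.prems(2)] c x
  have "(c \<otimes>\<^bsub>G\<^esub> ((inv\<^bsub>G\<^esub> c \<otimes>\<^bsub>G\<^esub> d) \<otimes>\<^bsub>G\<^esub> e), x \<otimes> (b \<otimes> q)) \<in> adjoin c x (Suc (n + m))"
    by (rule adjoin_times[OF Suc.IH[OF p(3) Suc.prems(2)]])
  then have "(d \<otimes>\<^bsub>G\<^esub> e, x \<otimes> (b \<otimes> q)) \<in> adjoin c x (Suc n + m)"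
    by (simp add: val_group.inv_cancel val_group.m_assoc del: adjoin.simps)
  moreover have "(d \<otimes>\<^bsub>G\<^esub> e, a \<otimes> q) \<in> adjoin c x (Suc n + m)"
    using adjoin_scale[OF p(2) Suc.prems(2)] adjoin_subset[of m "Suc n + m"] by (meson le_add2 subsetD)
  moreover have "p \<otimes> q = a \<otimes> q \<oplus> x \<otimes> (b \<otimes> q)"
    using p(1) by (simp add: l_distr m_assoc)
  ultimately show ?case using adjoin_add by metis
qed

text \<open>Products add the bounds on the number of powers of \<open>x\<close>, so only the union
  over all bounds is closed under multiplication. Sums are formed at the maximum of two
  bounds.\<close>

lemma filtration_adjoin: "filtration L G (\<Union>n. adjoin c x n)"
proof -
  define U where "U = (\<Union>n. adjoin c x n)"
  have I: "(d, q) \<in> U" if "(d, q) \<in> adjoin c x n" for d q n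
    using that by (auto simp: U_def)
  have E: "\<exists>n. (d, q) \<in> adjoin c x n" if "(d, q) \<in> U" for d q
    using that by (auto simp: U_def)
  have "filtration L G U"
  proof unfold_locales
    show "U \<subseteq> carrier G \<times> carrier L"
      by (rule subrelI) (use E adjoin_closed in blast)
    show "(d, \<zero>) \<in> U" if "d \<in> carrier G" for d
      by (rule I[OF adjoin_zero[OF that]])
    show "(\<one>\<^bsub>G\<^esub>, \<one>) \<in> U"
      by (rule I[of _ _ 0]) (simp add: has_one)
    fix d p assume "(d, p) \<in> U"
    then obtain n where p: "(d, p) \<in> adjoin c x n" using E by blast
    show "(d, \<ominus> p) \<in> U" by (rule I[OF adjoin_minus[OF p]])
    show "(e, p) \<in> U" if "e \<in> carrier G" "d \<preceq>\<^bsub>G\<^esub> e" for e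
      by (rule I[OF adjoin_mono[OF p that]])
    show "(d, p \<oplus> q) \<in> U" if dq: "(d, q) \<in> U" for q
    proof -
      obtain m where q: "(d, q) \<in> adjoin c x m" using E[OF dq] by blast
      have "(d, p) \<in> adjoin c x (max n m)" "(d, q) \<in> adjoin c x (max n m)"
        using p q adjoin_subset[of n "max n m"] adjoin_subset[of m "max n m"] by (auto dest: subsetD)
      then show ?thesis by (rule I[OF adjoin_add])
    qed
    show "(d \<otimes>\<^bsub>G\<^esub> e, p \<otimes> q) \<in> U" if eq: "(e, q) \<in> U" for e q
    proof -
      obtain m where "(e, q) \<in> adjoin c x m" using E[OF eq] by blast
      then show ?thesis by (rule I[OF adjoin_mult[OF p]])
    qed
  qed
  then show ?thesis by (simp add: U_def)
qed

lemma adjoin_generator: "(c, x) \<in> adjoin c x (Suc 0)"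
  using adjoin_times[of "\<one>\<^bsub>G\<^esub>" \<one> 0] has_one c x by simp

lemma adjoin_pow_times:
  "(d, q) \<in> adjoin c x n \<Longrightarrow> (c [^]\<^bsub>G\<^esub> k \<otimes>\<^bsub>G\<^esub> d, x [^] k \<otimes> q) \<in> adjoin c x (k + n)"
proof (induction k)
  case 0
  then show ?case using adjoin_closed[of d q n] by simp
next
  case (Suc k)
  then show ?case
    using adjoin_times[OF Suc.IH[OF Suc.prems]] adjoin_closed[OF Suc.prems] c x
    by (simp add: val_group.m_ac m_ac del: adjoin.simps)
qed

text \<open>The recursion of \<open>adjoin\<close> exposes the constant term, whereas Chevalley's
  argument has to replace the leading one. Multiplying the Horner tail by \<open>x\<close> keeps its
  leading coefficient, which gives the induction.\<close>

lemma adjoin_SucE: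
  assumes "(d, q) \<in> adjoin c x (Suc n)"
  obtains p a where "q = p \<oplus> x [^] Suc n \<otimes> a" "(d, p) \<in> adjoin c x n"
    "(inv\<^bsub>G\<^esub> (c [^]\<^bsub>G\<^esub> Suc n) \<otimes>\<^bsub>G\<^esub> d, a) \<in> P"
  using assms
proof (induction n arbitrary: d q thesis)
  case 0
  then show ?case using c x by force
next
  case (Suc n)
  obtain a b where q: "q = a \<oplus> x \<otimes> b" "(d, a) \<in> P"
    "(inv\<^bsub>G\<^esub> c \<otimes>\<^bsub>G\<^esub> d, b) \<in> adjoin c x (Suc n)"
    using Suc.prems(2) unfolding adjoin_Suc_iff[of _ _ "Suc n"] by auto
  obtain p a' where b: "b = p \<oplus> x [^] Suc n \<otimes> a'" "(inv\<^bsub>G\<^esub> c \<otimes>\<^bsub>G\<^esub> d, p) \<in> adjoin c x n"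
    "(inv\<^bsub>G\<^esub> (c [^]\<^bsub>G\<^esub> Suc n) \<otimes>\<^bsub>G\<^esub> (inv\<^bsub>G\<^esub> c \<otimes>\<^bsub>G\<^esub> d), a') \<in> P"
    using Suc.IH[OF _ q(3)] by blast
  note [simp] = closed[OF q(2)] conjunct2[OF adjoin_closed[OF b(2)]] closed(2)[OF b(3)] c x
  show ?case
  proof (rule Suc.prems(1))
    show "q = (a \<oplus> x \<otimes> p) \<oplus> x [^] Suc (Suc n) \<otimes> a'"
      using q(1) b(1) by (simp add: r_distr a_ac m_ac)
    show "(d, a \<oplus> x \<otimes> p) \<in> adjoin c x (Suc n)" using q(2) b(2) by auto
    show "(inv\<^bsub>G\<^esub> (c [^]\<^bsub>G\<^esub> Suc (Suc n)) \<otimes>\<^bsub>G\<^esub> d, a') \<in> P"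
      using b(3) by (simp add: val_group.inv_mult val_group.m_ac)
  qed
qed

end

section \<open>Relations in a homogeneous element and in its inverse\<close>

text \<open>Clearing denominators: multiplication by the \<open>n\<close>-th power of
  \<open>x\<close> reverses the coefficients of a polynomial in \<open>y\<close>. In the induction
  the constant term in \<open>y\<close> becomes the top term in \<open>x\<close>, and one factor
  \<open>x\<close> cancels the \<open>y\<close> before the tail.\<close>

lemma adjoin_inverse_pow_times:
  assumes "c \<in> carrier G" "x \<in> carrier L" "y \<in> carrier L" "x \<otimes> y = \<one>"
    and "(d, q) \<in> adjoin (inv\<^bsub>G\<^esub> c) y n"
  shows "(c [^]\<^bsub>G\<^esub> n \<otimes>\<^bsub>G\<^esub> d, x [^] n \<otimes> q) \<in> adjoin c x n"
  using assms(5)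
proof (induction n arbitrary: d q)
  case 0
  then show ?case using closed[of d q] by simp
next
  case (Suc n)
  note cl = assms(1-3)
  obtain a b where q: "q = a \<oplus> y \<otimes> b" "(d, a) \<in> P" "(c \<otimes>\<^bsub>G\<^esub> d, b) \<in> adjoin (inv\<^bsub>G\<^esub> c) y n"
    using Suc.prems cl by auto
  have [simp]: "b \<in> carrier L" using adjoin_closed[OF _ _ q(3)] cl by simp
  note [simp] = closed[OF q(2)] cl
  have "(c [^]\<^bsub>G\<^esub> n \<otimes>\<^bsub>G\<^esub> (c \<otimes>\<^bsub>G\<^esub> d), x [^] n \<otimes> b) \<in> adjoin c x (Suc n)"
    using Suc.IH[OF q(3)] adjoin_Suc_subset[of c x n] cl by blast
  moreover have "(c [^]\<^bsub>G\<^esub> Suc n \<otimes>\<^bsub>G\<^esub> d, x [^] Suc n \<otimes> a) \<in> adjoin c x (Suc n)"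
    using adjoin_pow_times[of c x d a 0 "Suc n"] q(2) by (simp del: adjoin.simps(2))
  moreover have "x [^] Suc n \<otimes> q = x [^] Suc n \<otimes> a \<oplus> x [^] n \<otimes> b"
  proof -
    have "x [^] Suc n \<otimes> (y \<otimes> b) = x [^] n \<otimes> (x \<otimes> y) \<otimes> b" by (simp add: m_assoc)
    then show ?thesis using assms(4) q(1) by (simp add: r_distr)
  qed
  ultimately show ?case
    using adjoin_add[OF cl(1,2), of "c [^]\<^bsub>G\<^esub> Suc n \<otimes>\<^bsub>G\<^esub> d"]
    by (simp add: val_group.m_assoc del: adjoin.simps)
qed


text \<open>
  Write \<open>1 = b + y b'\<close> by the second relation, and \<open>1 = q + x\<^bsup>n+1\<^esup> a\<close> by the first. Multiplying the
  first one by \<open>u = y b'\<close> and replacing \<open>x\<^bsup>n+1\<^esup> u\<close> by \<open>x\<^bsup>n-m\<^esup> (x\<^bsup>m\<^esup> b')\<close> lowers the degree of \<open>u\<close>, and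
  then \<open>1 = b + u\<close>. This way \<open>1 - b\<close> need not be inverted.
\<close>

lemma adjoin_descent:
  assumes "c \<in> carrier G" "x \<in> carrier L" "y \<in> carrier L" "x \<otimes> y = \<one>"
    and "e \<preceq>\<^bsub>G\<^esub> \<one>\<^bsub>G\<^esub>" "m \<le> n"
    and in_x: "(e, \<one>) \<in> adjoin c x (Suc n)" and in_y: "(e, \<one>) \<in> adjoin (inv\<^bsub>G\<^esub> c) y (Suc m)"
  shows "(e, \<one>) \<in> adjoin c x n"
proof -
  note cl = assms(1-3)
  note [simp] = cl
  have e [simp]: "e \<in> carrier G" using adjoin_closed[OF cl(1,2) in_x] by simp
  obtain b b' where y: "\<one> = b \<oplus> y \<otimes> b'" "(e, b) \<in> P" "(c \<otimes>\<^bsub>G\<^esub> e, b') \<in> adjoin (inv\<^bsub>G\<^esub> c) y m"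
    using in_y by auto
  obtain q a where x: "\<one> = q \<oplus> x [^] Suc n \<otimes> a" "(e, q) \<in> adjoin c x n"
    "(inv\<^bsub>G\<^esub> (c [^]\<^bsub>G\<^esub> Suc n) \<otimes>\<^bsub>G\<^esub> e, a) \<in> P"
    using in_x by (rule adjoin_SucE[OF cl(1,2)])
  have [simp]: "b' \<in> carrier L" using adjoin_closed[OF _ _ y(3)] by simp
  have [simp]: "q \<in> carrier L" using adjoin_closed[OF _ _ x(2)] by simp
  note [simp] = closed(2)[OF y(2)] closed(2)[OF x(3)]
  define u where "u = y \<otimes> b'"
  have u [simp]: "u \<in> carrier L" by (simp add: u_def)
  have one: "b \<oplus> u = \<one>" using y(1) by (simp add: u_def)
  \<comment> \<open>As \<open>\<one>\<close> minus a coefficient of degree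
    \<open>e \<preceq> \<one>\<close>, \<open>u\<close> is itself a coefficient of degree
    \<open>\<one>\<close>. Scaling \<open>q\<close> by it therefore keeps both the degree
    \<open>e\<close> and the bound \<open>n\<close>.\<close>
  have "u = \<ominus> b \<oplus> (b \<oplus> u)" by (simp add: r_neg1)
  also have "\<dots> = \<one> \<oplus> \<ominus> b" unfolding one by (rule a_comm) simp_all
  finally have "u = \<one> \<oplus> \<ominus> b" .
  then have "(\<one>\<^bsub>G\<^esub>, u) \<in> P" using y(2) assms(5) has_one by (auto intro: add minus mono)
  then have uq: "(e, u \<otimes> q) \<in> adjoin c x n"
    using adjoin_scale[OF cl(1,2) _ x(2)] by force
  define d where "d = c [^]\<^bsub>G\<^esub> m \<otimes>\<^bsub>G\<^esub> (c \<otimes>\<^bsub>G\<^esub> e)"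
  have "(d, x [^] m \<otimes> b') \<in> adjoin c x m"
    using adjoin_inverse_pow_times[OF cl assms(4) y(3)] by (simp add: d_def)
  \<comment> \<open>The factor \<open>x [^] (n - m)\<close> raises the bound \<open>m\<close> to
    exactly \<open>n\<close>, which is where \<open>m \<le> n\<close> matters. The powers of
    \<open>c\<close> cancel in the degree, leaving one \<open>e\<close> from each relation.\<close>
  then have "(c [^]\<^bsub>G\<^esub> (n - m) \<otimes>\<^bsub>G\<^esub> (inv\<^bsub>G\<^esub> (c [^]\<^bsub>G\<^esub> Suc n) \<otimes>\<^bsub>G\<^esub> e \<otimes>\<^bsub>G\<^esub> d),
      x [^] (n - m) \<otimes> (a \<otimes> (x [^] m \<otimes> b'))) \<in> adjoin c x (n - m + m)"
    by (intro adjoin_pow_times adjoin_scale x(3) cl)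
  moreover have "c [^]\<^bsub>G\<^esub> (n - m) \<otimes>\<^bsub>G\<^esub> (inv\<^bsub>G\<^esub> (c [^]\<^bsub>G\<^esub> Suc n) \<otimes>\<^bsub>G\<^esub> e \<otimes>\<^bsub>G\<^esub> d) = e \<otimes>\<^bsub>G\<^esub> e"
  proof -
    have pow: "c [^]\<^bsub>G\<^esub> Suc n = c [^]\<^bsub>G\<^esub> (n - m) \<otimes>\<^bsub>G\<^esub> c [^]\<^bsub>G\<^esub> m \<otimes>\<^bsub>G\<^esub> c"
      using assms(6) by (simp add: val_group.nat_pow_mult)
    define k where "k = c [^]\<^bsub>G\<^esub> Suc n"
    have [simp]: "k \<in> carrier G" by (simp add: k_def del: val_group.nat_pow_Suc)
    have "c [^]\<^bsub>G\<^esub> (n - m) \<otimes>\<^bsub>G\<^esub> (inv\<^bsub>G\<^esub> k \<otimes>\<^bsub>G\<^esub> e \<otimes>\<^bsub>G\<^esub> d) =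
        inv\<^bsub>G\<^esub> k \<otimes>\<^bsub>G\<^esub> (c [^]\<^bsub>G\<^esub> (n - m) \<otimes>\<^bsub>G\<^esub> c [^]\<^bsub>G\<^esub> m \<otimes>\<^bsub>G\<^esub> c) \<otimes>\<^bsub>G\<^esub> (e \<otimes>\<^bsub>G\<^esub> e)"
      by (simp add: d_def val_group.m_ac)
    also have "\<dots> = e \<otimes>\<^bsub>G\<^esub> e" unfolding pow[symmetric] k_def[symmetric] by simp
    finally show ?thesis by (simp add: k_def)
  qed
  moreover have "x [^] (n - m) \<otimes> (a \<otimes> (x [^] m \<otimes> b')) = u \<otimes> (x [^] Suc n \<otimes> a)"
  proof -
    have pow: "x [^] n = x [^] (n - m) \<otimes> x [^] m"
      using assms(6) by (simp add: nat_pow_mult)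
    have "u \<otimes> (x [^] Suc n \<otimes> a) = (x \<otimes> y) \<otimes> (x [^] n \<otimes> (a \<otimes> b'))"
      by (simp add: u_def m_ac)
    also have "\<dots> = x [^] (n - m) \<otimes> (a \<otimes> (x [^] m \<otimes> b'))"
      by (simp add: assms(4) pow m_ac)
    finally show ?thesis ..
  qed
  ultimately have "(e \<otimes>\<^bsub>G\<^esub> e, u \<otimes> (x [^] Suc n \<otimes> a)) \<in> adjoin c x n"
    using assms(6) by simp
  \<comment> \<open>Since \<open>e \<preceq> \<one>\<close>, the product of the two relations can be
    raised back to degree \<open>e\<close>.\<close>
  moreover have "e \<otimes>\<^bsub>G\<^esub> e \<preceq>\<^bsub>G\<^esub> e"
    using val_group.le_mult_right[OF _ _ _ assms(5), of e] by simp
  ultimately have "(e, u \<otimes> (x [^] Suc n \<otimes> a)) \<in> adjoin c x n"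
    by (rule adjoin_mono[OF cl(1,2) _ e])
  with uq have "(e, u \<otimes> q \<oplus> u \<otimes> (x [^] Suc n \<otimes> a)) \<in> adjoin c x n"
    by (rule adjoin_add[OF cl(1,2)])
  also have "u \<otimes> q \<oplus> u \<otimes> (x [^] Suc n \<otimes> a) = u \<otimes> (q \<oplus> x [^] Suc n \<otimes> a)"
    by (simp add: r_distr)
  also have "\<dots> = u"
    unfolding x(1)[symmetric] by simp
  finally have "(e, b \<oplus> u) \<in> adjoin c x n"
    using y(2) subset_adjoin[OF cl(1,2)] adjoin_add[OF cl(1,2)] by blast
  then show ?thesis by (simp add: one)
qed

text \<open>The descent lowers the larger of the two bounds, with \<open>x\<close> and
  \<open>y\<close> exchanged if the second one is larger. It ends when a bound is \<open>0\<close>,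
  where \<open>adjoin\<close> is \<open>P\<close> itself.\<close>

lemma one_in_both_adjoins:
  assumes "c \<in> carrier G" "x \<in> carrier L" "y \<in> carrier L" "x \<otimes> y = \<one>" "e \<preceq>\<^bsub>G\<^esub> \<one>\<^bsub>G\<^esub>"
    and "(e, \<one>) \<in> adjoin c x n" and "(e, \<one>) \<in> adjoin (inv\<^bsub>G\<^esub> c) y m"
  shows "(e, \<one>) \<in> P"
  using assms(6,7)
proof (induction "n + m" arbitrary: n m rule: less_induct)
  case less
  show ?case
  proof (cases "n = 0 \<or> m = 0")
    case True
    then show ?thesis using less.prems by auto
  next
    case False
    then obtain n' m' where nm: "n = Suc n'" "m = Suc m'" by (meson not0_implies_Suc)
    show ?thesis
    proof (cases "m' \<le> n'")
      case True
      have "(e, \<one>) \<in> adjoin c x n'"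
        by (rule adjoin_descent[OF assms(1-5) True]) (use less.prems nm in auto)
      then show ?thesis using less.hyps[of n' m] less.prems nm by simp
    next
      case False
      have "(e, \<one>) \<in> adjoin (inv\<^bsub>G\<^esub> c) y m'"
        by (rule adjoin_descent[of _ y x e n']) (use less.prems nm assms False in \<open>auto simp: m_comm\<close>)
      then show ?thesis using less.hyps[of n m'] less.prems nm by simp
    qed
  qed
qed

end

section \<open>Maximal proper filtrations\<close>

text \<open>Together with \<open>has_one\<close> and \<open>mono\<close> this makes
  \<open>(c, \<one>) \<in> P\<close> equivalent to \<open>\<one> \<preceq> c\<close>: the filtration
  imposes no new inequality on \<open>G\<close>, so the order of \<open>G\<close> survives in the
  value group.\<close>

definition (in field_with_ordered_group) proper :: "('g \<times> 'l) set \<Rightarrow> bool" where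
  "proper P \<longleftrightarrow> (\<forall>c\<in>carrier G. (c, \<one>) \<in> P \<longrightarrow> \<one>\<^bsub>G\<^esub> \<preceq>\<^bsub>G\<^esub> c)"

locale total_filtration = filtration L G P
  for L :: "('l, 'n) ring_scheme" (structure)
    and G :: "('g, 'p) ordered_monoid_scheme"
    and P +
  assumes is_proper: "proper P"
    and total: "\<lbrakk>c \<in> carrier G; x \<in> Units L\<rbrakk> \<Longrightarrow> (c, x) \<in> P \<or> (inv\<^bsub>G\<^esub> c, inv x) \<in> P"

context field_with_ordered_group
begin

text \<open>Each axiom involves at most two elements of the union, and in a chain two elements lie
  in a common member.\<close>

lemma filtration_Union_chain:
  assumes "\<C> \<noteq> {}" "subset.chain {P. filtration L G P} \<C>"
  shows "filtration L G (\<Union>\<C>)"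
proof -
  have filt: "filtration L G P" if "P \<in> \<C>" for P
    using assms(2) that by (auto simp: subset_chain_def)
  have common: "\<exists>P\<in>\<C>. p \<in> P \<and> q \<in> P" if "p \<in> \<Union>\<C>" "q \<in> \<Union>\<C>" for p q
    using assms(2) that by (meson UnionE subset_chain_def subsetD)
  obtain P where P: "P \<in> \<C>" using assms(1) by blast
  show ?thesis
  proof unfold_locales
    show "\<Union>\<C> \<subseteq> carrier G \<times> carrier L"
      by (rule Union_least) (rule filtration.subset[OF filt])
    show "(c, \<zero>) \<in> \<Union>\<C>" if "c \<in> carrier G" for c
      by (rule UnionI[OF P filtration.has_zero[OF filt[OF P] that]])
    show "(\<one>\<^bsub>G\<^esub>, \<one>) \<in> \<Union>\<C>"
      by (rule UnionI[OF P filtration.has_one[OF filt[OF P]]])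
    fix c a assume ca: "(c, a) \<in> \<Union>\<C>"
    then obtain Q where Q: "Q \<in> \<C>" "(c, a) \<in> Q" by blast
    show "(c, \<ominus> a) \<in> \<Union>\<C>"
      by (rule UnionI[OF Q(1) filtration.minus[OF filt[OF Q(1)] Q(2)]])
    show "(d, a) \<in> \<Union>\<C>" if "d \<in> carrier G" "c \<preceq>\<^bsub>G\<^esub> d" for d
      by (rule UnionI[OF Q(1) filtration.mono[OF filt[OF Q(1)] Q(2) that]])
    show "(c, a \<oplus> b) \<in> \<Union>\<C>" if cb: "(c, b) \<in> \<Union>\<C>" for b
    proof -
      obtain R where R: "R \<in> \<C>" "(c, a) \<in> R" "(c, b) \<in> R" using common[OF ca cb] by blast
      show ?thesis by (rule UnionI[OF R(1) filtration.add[OF filt[OF R(1)] R(2,3)]])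
    qed
    show "(c \<otimes>\<^bsub>G\<^esub> d, a \<otimes> b) \<in> \<Union>\<C>" if db: "(d, b) \<in> \<Union>\<C>" for d b
    proof -
      obtain R where R: "R \<in> \<C>" "(c, a) \<in> R" "(d, b) \<in> R" using common[OF ca db] by blast
      show ?thesis by (rule UnionI[OF R(1) filtration.mult[OF filt[OF R(1)] R(2,3)]])
    qed
  qed
qed

text \<open>If \<open>P\<close> misses both \<open>(c, x)\<close> and its inverse, adjoining either
  one destroys properness by maximality. Both extensions then contain \<open>\<one>\<close> in a
  degree below \<open>\<one>\<close>, and \<open>one_in_both_adjoins\<close> carries this back to
  \<open>P\<close>.\<close>

lemma maximal_proper_filtration_total:
  assumes "filtration L G P" "proper P"
    and max: "\<And>P'. \<lbrakk>filtration L G P'; proper P'; P \<subseteq> P'\<rbrakk> \<Longrightarrow> P' = P"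
  shows "total_filtration L G P"
proof -
  interpret filtration L G P by fact
  have improper: "\<exists>e n. e \<in> carrier G \<and> e \<preceq>\<^bsub>G\<^esub> \<one>\<^bsub>G\<^esub> \<and> \<not> \<one>\<^bsub>G\<^esub> \<preceq>\<^bsub>G\<^esub> e \<and> (e, \<one>) \<in> adjoin c x n"
    if "c \<in> carrier G" "x \<in> carrier L" "(c, x) \<notin> P" for c x
  proof -
    have "(c, x) \<in> (\<Union>n. adjoin c x n)" using adjoin_generator[OF that(1,2)] by blast
    moreover have "P \<subseteq> (\<Union>n. adjoin c x n)" using subset_adjoin[OF that(1,2)] by blast
    ultimately have "\<not> proper (\<Union>n. adjoin c x n)"
      using max[OF filtration_adjoin[OF that(1,2)]] that(3) by blast
    then show ?thesis unfolding proper_def using val_group.ord_linear by blast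
  qed
  show ?thesis
  proof unfold_locales
    show "proper P" by fact
    fix c x assume cx: "c \<in> carrier G" "x \<in> Units L"
    show "(c, x) \<in> P \<or> (inv\<^bsub>G\<^esub> c, inv x) \<in> P"
    proof (rule ccontr)
      assume neg: "\<not> ?thesis"
      note cl = cx(1) Units_closed[OF cx(2)]
      note cl' = val_group.inv_closed[OF cx(1)] Units_inv_closed[OF cx(2)]
      obtain d n where d: "d \<in> carrier G" "d \<preceq>\<^bsub>G\<^esub> \<one>\<^bsub>G\<^esub>" "\<not> \<one>\<^bsub>G\<^esub> \<preceq>\<^bsub>G\<^esub> d" "(d, \<one>) \<in> adjoin c x n"
        using improper[OF cl] neg by blast
      obtain e m where e: "e \<in> carrier G" "e \<preceq>\<^bsub>G\<^esub> \<one>\<^bsub>G\<^esub>" "\<not> \<one>\<^bsub>G\<^esub> \<preceq>\<^bsub>G\<^esub> e"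
        "(e, \<one>) \<in> adjoin (inv\<^bsub>G\<^esub> c) (inv x) m"
        using improper[OF cl'] neg by blast
      \<comment> \<open>The larger of the two degrees: both relations can be raised to it, and it is
        still strictly below \<open>\<one>\<close>.\<close>
      define f where "f = (if d \<preceq>\<^bsub>G\<^esub> e then e else d)"
      have f: "f \<in> carrier G" "f \<preceq>\<^bsub>G\<^esub> \<one>\<^bsub>G\<^esub>" "\<not> \<one>\<^bsub>G\<^esub> \<preceq>\<^bsub>G\<^esub> f" "d \<preceq>\<^bsub>G\<^esub> f" "e \<preceq>\<^bsub>G\<^esub> f"
        using d e val_group.ord_linear by (auto simp: f_def)
      have "(f, \<one>) \<in> P"
      proof (rule one_in_both_adjoins[OF cl cl'(2) _ f(2)])
        show "x \<otimes> inv x = \<one>" using cx by simp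
        show "(f, \<one>) \<in> adjoin c x n" using adjoin_mono[OF cl d(4)] f by blast
        show "(f, \<one>) \<in> adjoin (inv\<^bsub>G\<^esub> c) (inv x) m" using adjoin_mono[OF cl' e(4)] f by blast
      qed
      with \<open>proper P\<close> f show False by (auto simp: proper_def)
    qed
  qed
qed

text \<open>Zorn's lemma among the proper filtrations above \<open>P\<close>. Properness is tested
  on one pair at a time and hence passes to unions.\<close>

lemma total_filtration_extension:
  assumes "filtration L G P" "proper P"
  shows "\<exists>P'. total_filtration L G P' \<and> P \<subseteq> P'"
proof -
  define \<A> where "\<A> = {P'. filtration L G P' \<and> proper P' \<and> P \<subseteq> P'}"
  have "\<exists>M\<in>\<A>. \<forall>X\<in>\<A>. M \<subseteq> X \<longrightarrow> X = M"
  proof (rule subset_Zorn_nonempty)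
    show "\<A> \<noteq> {}" using assms by (auto simp: \<A>_def)
    fix \<C> assume \<C>: "\<C> \<noteq> {}" "subset.chain \<A> \<C>"
    then have sub: "\<C> \<subseteq> \<A>" by (simp add: subset_chain_def)
    have "subset.chain {P. filtration L G P} \<C>"
      using \<C>(2) by (auto simp: subset_chain_def \<A>_def)
    then have "filtration L G (\<Union>\<C>)" by (rule filtration_Union_chain[OF \<C>(1)])
    moreover have "proper (\<Union>\<C>)"
      using sub by (auto simp: proper_def \<A>_def)
    moreover have "P \<subseteq> \<Union>\<C>" using sub \<C>(1) by (auto simp: \<A>_def)
    ultimately show "\<Union>\<C> \<in> \<A>" by (simp add: \<A>_def)
  qed
  then obtain M where M: "M \<in> \<A>" "\<And>X. X \<in> \<A> \<Longrightarrow> M \<subseteq> X \<Longrightarrow> X = M" by blast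
  have "total_filtration L G M"
    by (rule maximal_proper_filtration_total) (use M in \<open>auto simp: \<A>_def\<close>)
  then show ?thesis using M(1) by (auto simp: \<A>_def)
qed

end

section \<open>Value group and valuation of a total filtration\<close>

context total_filtration
begin

lemmas [simp] = units_of_carrier units_of_mult units_of_one

abbreviation pair_group where "pair_group \<equiv> G \<times>\<times> units_of L"

text \<open>A pair \<open>(c, x)\<close> stands for \<open>c \<cdot> w x\<close>; the cone consists of the pairs that are at least \<open>1\<close>.\<close>

definition cone where "cone = {(c, x) \<in> carrier G \<times> Units L. (c, inv x) \<in> P}"

lemma cone_iff: "(c, x) \<in> cone \<longleftrightarrow> c \<in> carrier G \<and> x \<in> Units L \<and> (c, inv x) \<in> P"
  by (simp add: cone_def)

lemma comm_group_pair_group: "comm_group pair_group"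
proof -
  interpret units: comm_group "units_of L" by (rule units_comm_group)
  interpret pair: group pair_group by (intro DirProd_group val_group.is_group units.is_group)
  show ?thesis
    by (rule pair.group_comm_groupI)
      (auto simp: DirProd_def val_group.m_comm m_comm Units_closed)
qed

sublocale pair: comm_group pair_group
  by (rule comm_group_pair_group)

lemma carrier_pair_group [simp]: "carrier pair_group = carrier G \<times> Units L"
  by (simp add: units_of_carrier)

lemma mult_pair_group [simp]: "(c, x) \<otimes>\<^bsub>pair_group\<^esub> (d, y) = (c \<otimes>\<^bsub>G\<^esub> d, x \<otimes> y)"
  by (simp add: units_of_mult)

lemma one_pair_group [simp]: "\<one>\<^bsub>pair_group\<^esub> = (\<one>\<^bsub>G\<^esub>, \<one>)"
  by (simp add: units_of_one)

lemma inv_pair_group [simp]: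
  assumes "c \<in> carrier G" "x \<in> Units L"
  shows "inv\<^bsub>pair_group\<^esub> (c, x) = (inv\<^bsub>G\<^esub> c, inv x)"
  by (rule pair.inv_equality) (use assms in auto)

lemma inv_mult_Units: "\<lbrakk>x \<in> Units L; y \<in> Units L\<rbrakk> \<Longrightarrow> inv (x \<otimes> y) = inv x \<otimes> inv y"
  by (rule comm_inv_char) (auto simp: m_ac Units_closed)

sublocale total_cone pair_group cone
proof unfold_locales
  show "cone \<subseteq> carrier pair_group" by (auto simp: cone_def)
  show "\<one>\<^bsub>pair_group\<^esub> \<in> cone" using has_one by (simp add: cone_def)
  \<comment> \<open>\<open>cone\<close> tests the inverse of the second component. Hence products
    need \<open>inv_mult_Units\<close>, and \<open>total\<close> is applied to
    \<open>inv (snd p)\<close> below.\<close>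
  show "p \<otimes>\<^bsub>pair_group\<^esub> q \<in> cone" if "p \<in> cone" "q \<in> cone" for p q
    using that by (auto simp: cone_def inv_mult_Units intro: mult)
  show "p \<in> cone \<or> inv\<^bsub>pair_group\<^esub> p \<in> cone" if "p \<in> carrier pair_group" for p
    using that total[of "fst p" "inv (snd p)"] by (auto simp: cone_def)
qed

text \<open>The class of \<open>c \<cdot> w x\<close>. Thus \<open>cls c \<one>\<close> is the image
  of \<open>c\<close> in the new value group, and \<open>cls\<close> with first argument
  \<open>\<one>\<close> gives the values of nonzero elements of \<open>L\<close>.\<close>

definition cls where "cls c x = cone_kernel #>\<^bsub>pair_group\<^esub> (c, x)"

definition value_map where "value_map x = (if x = \<zero> then None else Some (cls \<one>\<^bsub>G\<^esub> x))"

lemma cls_closed: "\<lbrakk>c \<in> carrier G; x \<in> Units L\<rbrakk> \<Longrightarrow> cls c x \<in> carrier cone_quotient"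
  by (auto simp: cls_def RCOSETS_def)

lemma cls_one: "cls \<one>\<^bsub>G\<^esub> \<one> = \<one>\<^bsub>cone_quotient\<^esub>"
  using pair.coset_mult_one[of cone_kernel] kernel.subset by (simp add: cls_def)

lemma cls_mult:
  "\<lbrakk>c \<in> carrier G; x \<in> Units L; d \<in> carrier G; y \<in> Units L\<rbrakk>
    \<Longrightarrow> cls c x \<otimes>\<^bsub>cone_quotient\<^esub> cls d y = cls (c \<otimes>\<^bsub>G\<^esub> d) (x \<otimes> y)"
  by (simp add: cls_def kernel.rcos_sum)

text \<open>The inequality \<open>c \<cdot> w x \<le> d \<cdot> w y\<close> rewritten as
  \<open>w (x / y) \<le> d / c\<close>.\<close>

lemma cls_le_iff:
  assumes "c \<in> carrier G" "x \<in> Units L" "d \<in> carrier G" "y \<in> Units L"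
  shows "cls c x \<preceq>\<^bsub>cone_quotient\<^esub> cls d y \<longleftrightarrow> (d \<otimes>\<^bsub>G\<^esub> inv\<^bsub>G\<^esub> c, x \<otimes> inv y) \<in> P"
proof -
  have "inv (y \<otimes> inv x) = x \<otimes> inv y"
    using assms by (simp add: inv_mult_Units m_comm Units_closed)
  then show ?thesis using assms by (simp add: cls_def coset_le_iff cone_iff Units_closed)
qed

sublocale quotient: totally_ordered_comm_group cone_quotient
  by (rule totally_ordered_cone_quotient)

text \<open>Properness shows that the order of \<open>G\<close> is reflected, \<open>has_one\<close>
  and \<open>mono\<close> that it is preserved. Injectivity then follows from antisymmetry in
  \<open>G\<close>.\<close>

lemma ordered_group_embedding_cls:
  "ordered_group_embedding (\<lambda>c. cls c \<one>) G cone_quotient"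
proof -
  have le: "cls c \<one> \<preceq>\<^bsub>cone_quotient\<^esub> cls d \<one> \<longleftrightarrow> c \<preceq>\<^bsub>G\<^esub> d"
    if "c \<in> carrier G" "d \<in> carrier G" for c d
  proof -
    have "(d \<otimes>\<^bsub>G\<^esub> inv\<^bsub>G\<^esub> c, \<one>) \<in> P \<longleftrightarrow> \<one>\<^bsub>G\<^esub> \<preceq>\<^bsub>G\<^esub> d \<otimes>\<^bsub>G\<^esub> inv\<^bsub>G\<^esub> c"
      using is_proper mono[OF has_one, of "d \<otimes>\<^bsub>G\<^esub> inv\<^bsub>G\<^esub> c"] that by (auto simp: proper_def)
    then show ?thesis using that val_group.ord_iff_one_ord_div[OF that] by (simp add: cls_le_iff)
  qed
  moreover have "(\<lambda>c. cls c \<one>) \<in> hom G cone_quotient"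
    by (rule homI) (simp_all add: cls_closed cls_mult del: cone_quotient_simps)
  moreover have "inj_on (\<lambda>c. cls c \<one>) (carrier G)"
  proof (rule inj_onI)
    fix c d assume cd: "c \<in> carrier G" "d \<in> carrier G" "cls c \<one> = cls d \<one>"
    then have "cls c \<one> \<preceq>\<^bsub>cone_quotient\<^esub> cls d \<one>" "cls d \<one> \<preceq>\<^bsub>cone_quotient\<^esub> cls c \<one>"
      by (simp_all add: cls_closed del: cone_quotient_simps)
    then show "c = d" using cd le val_group.ord_antisym by blast
  qed
  ultimately show ?thesis by (simp add: ordered_group_embedding_def)
qed

text \<open>Division by \<open>y\<close> turns a comparison of values into membership in the
  valuation ring, the part of \<open>P\<close> of degree \<open>\<one>\<close>. Closure of
  \<open>P\<close> under sums and negation thereby transfers to values.\<close>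

lemma value_map_le_iff:
  assumes "x \<in> carrier L" "y \<in> Units L"
  shows "with_zero_le cone_quotient (value_map x) (value_map y) \<longleftrightarrow> (\<one>\<^bsub>G\<^esub>, x \<otimes> inv y) \<in> P"
  using assms by (auto simp: value_map_def field_Units cls_le_iff has_zero)

lemma value_map_le_zero_iff:
  "with_zero_le cone_quotient (value_map x) (value_map \<zero>) \<longleftrightarrow> x = \<zero>"
  by (simp add: value_map_def)

lemma value_map_linear:
  assumes "x \<in> carrier L" "y \<in> carrier L"
  shows "with_zero_le cone_quotient (value_map x) (value_map y) \<or>
    with_zero_le cone_quotient (value_map y) (value_map x)"
  using assms quotient.ord_linear[OF cls_closed cls_closed]
  by (auto simp: value_map_def field_Units)

lemma value_map_refl:
  "x \<in> carrier L \<Longrightarrow> with_zero_le cone_quotient (value_map x) (value_map x)"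
  using value_map_linear by blast

lemma value_map_le_add:
  assumes "x \<in> carrier L" "y \<in> carrier L" "z \<in> carrier L"
    and "with_zero_le cone_quotient (value_map x) (value_map z)"
    and "with_zero_le cone_quotient (value_map y) (value_map z)"
  shows "with_zero_le cone_quotient (value_map (x \<oplus> y)) (value_map z)"
proof (cases "z = \<zero>")
  case True
  then show ?thesis using assms by (simp add: value_map_le_zero_iff)
next
  case False
  then have "z \<in> Units L" using assms by (simp add: field_Units)
  then show ?thesis using assms by (simp add: value_map_le_iff l_distr add)
qed

lemma value_map_minus:
  assumes "x \<in> carrier L" "z \<in> carrier L"
    and "with_zero_le cone_quotient (value_map x) (value_map z)"
  shows "with_zero_le cone_quotient (value_map (\<ominus> x)) (value_map z)"
proof (cases "z = \<zero>")
  case True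
  then show ?thesis using assms by (simp add: value_map_le_zero_iff)
next
  case False
  then have "z \<in> Units L" using assms by (simp add: field_Units)
  then show ?thesis using assms by (simp add: value_map_le_iff l_minus minus)
qed

lemma value_map_add_le_max:
  assumes "x \<in> carrier L" "y \<in> carrier L"
  shows "with_zero_le cone_quotient (value_map (x \<oplus> y))
    (with_zero_max cone_quotient (value_map x) (value_map y))"
  using assms value_map_le_add[OF assms] value_map_linear[OF assms] value_map_refl
  by (auto simp: with_zero_max_def)

lemma valuation_value_map: "valuation L cone_quotient value_map"
proof unfold_locales
  show "value_map \<in> carrier L \<rightarrow> carrier (with_zero cone_quotient)"
    using cls_closed by (auto simp: value_map_def with_zero_def field_Units)
  show "value_map \<zero> = \<zero>\<^bsub>with_zero cone_quotient\<^esub>"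
    by (simp add: value_map_def with_zero_def)
  show "value_map \<one> = \<one>\<^bsub>with_zero cone_quotient\<^esub>"
    by (simp add: value_map_def with_zero_def cls_one del: cone_quotient_simps)
  fix x y assume xy: "x \<in> carrier L" "y \<in> carrier L"
  show "value_map (x \<otimes> y) = value_map x \<otimes>\<^bsub>with_zero cone_quotient\<^esub> value_map y"
    using xy cls_mult[of "\<one>\<^bsub>G\<^esub>" x "\<one>\<^bsub>G\<^esub>" y]
    by (auto simp: value_map_def with_zero_def field_Units integral_iff)
  show "with_zero_le cone_quotient (value_map (x \<oplus> y))
      (value_map x \<oplus>\<^bsub>with_zero cone_quotient\<^esub> value_map y)"
    using value_map_add_le_max xy by (simp add: with_zero_def)
  \<comment> \<open>The last valuation axiom is the ultrametric inequality for \<open>x\<close>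
    written as the sum of \<open>x \<oplus> y\<close> and \<open>\<ominus> y\<close>, once
    \<open>y\<close> and \<open>\<ominus> y\<close> have the same value.\<close>
  have "value_map (\<ominus> y) = value_map y"
  proof (cases "y = \<zero>")
    case False
    then have Units: "y \<in> Units L" "\<ominus> y \<in> Units L"
      using xy by (auto simp: field_Units)
    have "with_zero_le cone_quotient (value_map (\<ominus> y)) (value_map y)"
      "with_zero_le cone_quotient (value_map y) (value_map (\<ominus> y))"
      using value_map_minus[of y y] value_map_minus[of "\<ominus> y" "\<ominus> y"] value_map_refl xy by auto
    then show ?thesis
      using Units quotient.ord_antisym[OF _ _ cls_closed cls_closed]
      by (simp add: value_map_def field_Units)
  qed simp
  then show "with_zero_le cone_quotient (value_map x)
      (value_map (x \<oplus> y) \<oplus>\<^bsub>with_zero cone_quotient\<^esub> value_map y)"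
    using value_map_add_le_max[of "x \<oplus> y" "\<ominus> y"] xy by (simp add: with_zero_def a_assoc r_neg)
qed

text \<open>The two memberships bound \<open>w x\<close> by \<open>c\<close> from above and from
  below, so antisymmetry applies.\<close>

lemma cls_eq_value:
  assumes "x \<in> Units L" "(c, x) \<in> P" "(inv\<^bsub>G\<^esub> c, inv x) \<in> P"
  shows "value_map x = Some (cls c \<one>)"
proof -
  have c: "c \<in> carrier G" using closed assms by blast
  then have "cls \<one>\<^bsub>G\<^esub> x \<preceq>\<^bsub>cone_quotient\<^esub> cls c \<one>" "cls c \<one> \<preceq>\<^bsub>cone_quotient\<^esub> cls \<one>\<^bsub>G\<^esub> x"
    using assms by (simp_all add: cls_le_iff Units_closed)
  then have "cls \<one>\<^bsub>G\<^esub> x = cls c \<one>"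
    using quotient.ord_antisym cls_closed c assms by simp
  then show ?thesis using assms(1) by (auto simp: value_map_def field_Units)
qed

end

section \<open>The filtration defined by a valuation\<close>

context valuation
begin

lemma val_cases:
  assumes "x \<in> carrier R"
  obtains "v x = None" | c where "v x = Some c" "c \<in> carrier G"
  using funcset_mem[OF val_closed assms] that by (auto simp: with_zero_def)

lemma val_le_add:
  assumes "x \<in> carrier R" "y \<in> carrier R" "c \<in> carrier G"
    and "with_zero_le G (v x) (Some c)" "with_zero_le G (v y) (Some c)"
  shows "with_zero_le G (v (x \<oplus> y)) (Some c)"
  using val_add[OF assms(1,2)] assms(3-5)
  by (rule_tac val_cases[OF assms(1)]; rule_tac val_cases[OF assms(2)];
      rule_tac val_cases[of "x \<oplus> y"])
    (auto simp: assms with_zero_def with_zero_max_def split: if_splits intro: val_group.ord_trans)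

lemma val_le_mult:
  assumes "x \<in> carrier R" "y \<in> carrier R" "c \<in> carrier G" "d \<in> carrier G"
    and "with_zero_le G (v x) (Some c)" "with_zero_le G (v y) (Some d)"
  shows "with_zero_le G (v (x \<otimes> y)) (Some (c \<otimes>\<^bsub>G\<^esub> d))"
  using val_mult[OF assms(1,2)] assms(3-6)
  by (rule_tac val_cases[OF assms(1)]; rule_tac val_cases[OF assms(2)])
    (auto simp: with_zero_def intro: val_group.ord_mult_mono)

lemma val_le_mono:
  assumes "x \<in> carrier R" "c \<in> carrier G" "d \<in> carrier G"
    and "with_zero_le G (v x) (Some c)" "c \<preceq>\<^bsub>G\<^esub> d"
  shows "with_zero_le G (v x) (Some d)"
  using assms by (rule_tac val_cases[OF assms(1)]) (auto intro: val_group.ord_trans)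

text \<open>The axiom \<open>val_add'\<close> for \<open>\<ominus> x\<close> and \<open>x\<close>:
  their sum has value \<open>None\<close>, which drops out of the maximum.\<close>

lemma val_minus_le:
  assumes "x \<in> carrier R"
  shows "with_zero_le G (v (\<ominus> x)) (v x)"
  using val_add'[of "\<ominus> x" x] assms val_zero
  by (simp add: l_neg with_zero_def with_zero_max_def)

lemma val_le_minus:
  assumes "x \<in> carrier R" "c \<in> carrier G" "with_zero_le G (v x) (Some c)"
  shows "with_zero_le G (v (\<ominus> x)) (Some c)"
  using val_minus_le[OF assms(1)] assms(2,3)
  by (rule_tac val_cases[OF assms(1)]; rule_tac val_cases[of "\<ominus> x"])
    (auto simp: assms intro: val_group.ord_trans)

text \<open>The values of \<open>x\<close> and \<open>inv x\<close> multiply to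
  \<open>\<one>\<close>, so neither is \<open>None\<close> and they are inverse to each
  other.\<close>

lemma val_Units:
  assumes "x \<in> Units R"
  obtains c where "c \<in> carrier G" "v x = Some c" "v (inv x) = Some (inv\<^bsub>G\<^esub> c)"
proof -
  have "with_zero_mult G (v x) (v (inv x)) = Some \<one>\<^bsub>G\<^esub>"
    using val_mult[of x "inv x"] val_one assms by (simp add: with_zero_def Units_closed)
  then obtain c d where cd: "v x = Some c" "v (inv x) = Some d" "c \<otimes>\<^bsub>G\<^esub> d = \<one>\<^bsub>G\<^esub>"
    by (cases "v x"; cases "v (inv x)") auto
  then have "c \<in> carrier G" "d \<in> carrier G"
    using assms val_cases[of x] val_cases[of "inv x"] by auto
  with cd show thesis
    using that[of c] val_group.inv_equality[of d c] by (simp add: val_group.m_comm)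
qed

end

text \<open>Each axiom is checked on chosen preimages under \<open>h\<close>. Injectivity of
  \<open>h\<close> enters only later, in the proof of \<open>proper P\<close>.\<close>

lemma (in valuation) filtration_of_valuation:
  assumes "field L" "h \<in> ring_hom R L"
  defines "P \<equiv> {(c, h x) |c x. c \<in> carrier G \<and> x \<in> carrier R \<and> with_zero_le G (v x) (Some c)}"
  shows "filtration L G P"
proof -
  interpret L: field L by fact
  interpret h: ring_hom_ring R L h
    by (intro ring_hom_ringI2 ring_axioms L.ring_axioms assms(2))
  have I: "(c, h x) \<in> P" if "c \<in> carrier G" "x \<in> carrier R" "with_zero_le G (v x) (Some c)" for c x
    using that by (auto simp: P_def)
  have E: "\<exists>x. a = h x \<and> c \<in> carrier G \<and> x \<in> carrier R \<and> with_zero_le G (v x) (Some c)"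
    if "(c, a) \<in> P" for c a
    using that by (auto simp: P_def)
  show ?thesis
  proof unfold_locales
    show "P \<subseteq> carrier G \<times> carrier L" by (auto simp: P_def)
    show "(c, \<zero>\<^bsub>L\<^esub>) \<in> P" if "c \<in> carrier G" for c
      using I[of c \<zero>] that val_zero by (simp add: with_zero_def)
    show "(\<one>\<^bsub>G\<^esub>, \<one>\<^bsub>L\<^esub>) \<in> P"
      using I[of "\<one>\<^bsub>G\<^esub>" \<one>] val_one by (simp add: with_zero_def)
    fix c a assume "(c, a) \<in> P"
    then obtain x where a: "a = h x"
      and x: "c \<in> carrier G" "x \<in> carrier R" "with_zero_le G (v x) (Some c)"
      using E by blast
    show "(c, \<ominus>\<^bsub>L\<^esub> a) \<in> P"
      using I[of c "\<ominus> x"] val_le_minus[OF x(2,1,3)] x by (simp add: a)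
    show "(d, a) \<in> P" if "d \<in> carrier G" "c \<preceq>\<^bsub>G\<^esub> d" for d
      using I[of d x] val_le_mono[OF x(2,1) that(1) x(3) that(2)] x that by (simp add: a)
    fix d b assume "(d, b) \<in> P"
    then obtain y where b: "b = h y"
      and y: "d \<in> carrier G" "y \<in> carrier R" "with_zero_le G (v y) (Some d)"
      using E by blast
    show "(c \<otimes>\<^bsub>G\<^esub> d, a \<otimes>\<^bsub>L\<^esub> b) \<in> P"
      using I[of "c \<otimes>\<^bsub>G\<^esub> d" "x \<otimes> y"] val_le_mult[OF x(2) y(2) x(1) y(1) x(3) y(3)] x y
      by (simp add: a b)
  next
    fix c a b assume "(c, a) \<in> P" "(c, b) \<in> P"
    then obtain x y where ab: "a = h x" "b = h y"
      and x: "c \<in> carrier G" "x \<in> carrier R" "with_zero_le G (v x) (Some c)"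
      and y: "y \<in> carrier R" "with_zero_le G (v y) (Some c)"
      using E by meson
    show "(c, a \<oplus>\<^bsub>L\<^esub> b) \<in> P"
      using I[of c "x \<oplus> y"] val_le_add[OF x(2) y(1) x(1) x(3) y(2)] x y by (simp add: ab)
  qed
qed

theorem theorem9p7:
  fixes K :: "('k, 'm) ring_scheme"
    and L :: "('l, 'n) ring_scheme"
    and \<Gamma> :: "('g, 'p) ordered_monoid_scheme"
    and v :: "'k \<Rightarrow> 'g option"
    and h :: "'k \<Rightarrow> 'l"
  assumes "field K"
    and "totally_ordered_comm_group \<Gamma>"
    and "valuation K \<Gamma> v"
    and "field L"
    and "h \<in> ring_hom K L"
  shows "\<exists>(\<Gamma>' :: ('g \<times> 'l) set ordered_monoid) (\<iota> :: 'g \<Rightarrow> ('g \<times> 'l) set)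
            (w :: 'l \<Rightarrow> ('g \<times> 'l) set option).
          totally_ordered_comm_group \<Gamma>' \<and>
          ordered_group_embedding \<iota> \<Gamma> \<Gamma>' \<and>
          valuation L \<Gamma>' w \<and>
          (\<forall>x\<in>carrier K. w (h x) = map_option \<iota> (v x))"
proof -
  interpret K: field K by fact
  interpret L: field L by fact
  interpret v: valuation K \<Gamma> v by fact
  interpret field_with_ordered_group L \<Gamma> by unfold_locales
  interpret h: ring_hom_ring K L h
    by (intro ring_hom_ringI2 K.ring_axioms L.ring_axioms assms(5))
  define P where
    "P = {(c, h x) |c x. c \<in> carrier \<Gamma> \<and> x \<in> carrier K \<and> with_zero_le \<Gamma> (v x) (Some c)}"
  have inj: "inj_on h (carrier K)"
    using non_trivial_field_hom_is_inj[OF assms(5,1,4)] .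
  have "filtration L \<Gamma> P"
    unfolding P_def by (rule v.filtration_of_valuation[OF assms(4,5)])
  moreover have "proper P"
    unfolding proper_def
  proof (intro ballI impI)
    fix c assume c: "c \<in> carrier \<Gamma>" "(c, \<one>\<^bsub>L\<^esub>) \<in> P"
    then obtain x where x: "h x = h \<one>\<^bsub>K\<^esub>" "x \<in> carrier K" "with_zero_le \<Gamma> (v x) (Some c)"
      by (auto simp: P_def)
    \<comment> \<open>Injectivity of \<open>h\<close> ensures that the \<open>\<one>\<close> of
      \<open>L\<close> does not come from an element of \<open>K\<close> of smaller value.\<close>
    then have "x = \<one>\<^bsub>K\<^esub>" using inj_onD[OF inj x(1)] by simp
    with x show "\<one>\<^bsub>\<Gamma>\<^esub> \<preceq>\<^bsub>\<Gamma>\<^esub> c" by (simp add: v.val_one with_zero_def)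
  qed
  ultimately obtain P' where "total_filtration L \<Gamma> P'" and P': "P \<subseteq> P'"
    using total_filtration_extension by blast
  then interpret T: total_filtration L \<Gamma> P' by simp
  have "T.value_map (h x) = map_option (\<lambda>c. T.cls c \<one>\<^bsub>L\<^esub>) (v x)" if x: "x \<in> carrier K" for x
  proof (cases "x = \<zero>\<^bsub>K\<^esub>")
    case True
    then show ?thesis by (simp add: T.value_map_def v.val_zero with_zero_def)
  next
    case False
    then have U: "x \<in> Units K" using x by (simp add: K.field_Units)
    obtain c where c: "c \<in> carrier \<Gamma>" "v x = Some c" "v (inv\<^bsub>K\<^esub> x) = Some (inv\<^bsub>\<Gamma>\<^esub> c)"
      using v.val_Units[OF U] .
    have cl: "h x \<in> carrier L" "h (inv\<^bsub>K\<^esub> x) \<in> carrier L" using U x by auto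
    have prod: "h x \<otimes>\<^bsub>L\<^esub> h (inv\<^bsub>K\<^esub> x) = \<one>\<^bsub>L\<^esub>"
      using U x h.hom_mult[of x "inv\<^bsub>K\<^esub> x"] by simp
    then have inv: "h (inv\<^bsub>K\<^esub> x) = inv\<^bsub>L\<^esub> (h x)" "h x \<in> Units L"
      using L.comm_inv_char[OF cl] L.m_comm[OF cl] cl by (auto simp: Units_def)
    \<comment> \<open>Both \<open>x\<close> and its inverse enter \<open>P\<close> at their exact
      values. Since these values are inverse to each other, \<open>w (h x)\<close> is bounded by
      \<open>c\<close> on both sides.\<close>
    have "(c, h x) \<in> P'" "(inv\<^bsub>\<Gamma>\<^esub> c, h (inv\<^bsub>K\<^esub> x)) \<in> P'"
    proof -
      have "(d, h y) \<in> P'" if "d \<in> carrier \<Gamma>" "y \<in> carrier K" "v y = Some d" for d y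
        using that P' by (force simp: P_def)
      then show "(c, h x) \<in> P'" "(inv\<^bsub>\<Gamma>\<^esub> c, h (inv\<^bsub>K\<^esub> x)) \<in> P'" using c x U by auto
    qed
    then show ?thesis using T.cls_eq_value[OF inv(2)] inv(1) c(2) by simp
  qed
  then show ?thesis
    using T.totally_ordered_cone_quotient T.ordered_group_embedding_cls T.valuation_value_map
    by (intro exI[of _ T.cone_quotient] exI[of _ "\<lambda>c. T.cls c \<one>\<^bsub>L\<^esub>"] exI[of _ T.value_map]
        conjI ballI)
qed

end
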